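(* Let $A, B > 0$ be real constants and let $(R_L)_{L\geq0}$ be a sequence of Lebesgue measurable subsets of $[0,1)$ such that for every $L$, $\mathbb{P}(R_L) \geq B^{-L}$ and $R_L$ is a disjoint union of at most $A^L$ intervals. Then for almost all $\alpha \in [0,1)$ and every $\eta > 0$, there are infinitely many $L$ for which there exists a positive integer $h_L$ with $$h_L \leq (1+\eta)^L \frac{1}{\mathbb{P}(R_L)} \qquad\text{and}\qquad \{h_L \alpha\} \in R_L.$$
   Context: $\mathbb{P}$ denotes one-dimensional Lebesgue measure; $\{x\}$ denotes the fractional part of a real number $x$. *)

theory Defs
  imports "HOL-Analysis.Analysis"
begin

definition disjoint_union_of_at_most_intervals :: "real \<Rightarrow> real set \<Rightarrow> bool" where
  "disjoint_union_of_at_most_intervals N S \<longleftrightarrow>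
     (\<exists>\<I>. finite \<I> \<and> real (card \<I>) \<le> N \<and> (\<forall>I\<in>\<I>. is_interval I) \<and>
          disjoint \<I> \<and> \<Union>\<I> = S)"

end

theory Submission
  imports Defs "HOL-Real_Asymp.Real_Asymp"
begin

text \<open>
  Fix \<open>L\<close>, let \<open>p\<close> be the measure of \<open>R L\<close>, let \<open>N\<close> be the integer part of \<open>(1 + \<eta>) ^ L / p\<close>, and
  consider only odd primes \<open>q \<le> N\<close> as multipliers. The circle is discretised to the residues
  modulo \<open>Q = 2 ^ (8 * t)\<close>, where \<open>t\<close> is a multiple of \<open>L\<close>, and \<open>R L\<close> is replaced by the set \<open>G\<close> of residues
  \<open>i\<close> such that \<open>[i / Q, (i + N) / Q)\<close> lies in one of the intervals; \<open>G\<close> has density at least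
  \<open>p / 2\<close> and few boundary points.
  A second moment bound for the number of \<open>q\<close> with \<open>q * j mod Q \<in> G\<close> uses the Fourier transform
  modulo \<open>Q\<close>. High frequencies carry little energy because \<open>G\<close> has few boundary points. A
  product \<open>q * k\<close> of a prime and a low frequency determines \<open>q\<close> up to \<open>O(L)\<close> choices, so the low
  frequencies of the dilates are nearly orthogonal. By Chebyshev's lower bound there are about
  \<open>N / L\<close> primes, hence the expected number of hits exceeds the variance loss by an exponential
  factor and the exceptional set has measure tending to \<open>0\<close> with \<open>L\<close>.
\<close>

subsection \<open>Chebyshev lower bound\<close>

lemma div_Suc_indicator:
  fixes n d :: nat
  shows "Suc n div d = n div d + of_bool (d dvd Suc n)"
  by (auto simp: div_Suc dvd_eq_mod_eq_0)

text \<open>Legendre's formula, cut off at \<open>M\<close> because higher powers of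
  \<open>p\<close> exceed \<open>n\<close>. Passing from \<open>n\<close> to \<open>Suc n\<close>
  raises the \<open>i\<close>-th quotient by one exactly when \<open>p ^ i\<close> divides
  \<open>Suc n\<close>, which happens for as many \<open>i\<close> as the multiplicity of
  \<open>p\<close> in \<open>Suc n\<close>.\<close>

lemma multiplicity_fact_eq_sum_div:
  fixes p n M :: nat
  assumes "prime p" "n < p ^ Suc M"
  shows "multiplicity p (fact n :: nat) = (\<Sum>i=1..M. n div p ^ i)"
  using assms(2)
proof (induction n)
  case 0
  then show ?case by simp
next
  case (Suc n)
  have p: "p > 1" using assms(1) by (rule prime_gt_1_nat)
  have dvd_iff: "p ^ i dvd Suc n \<longleftrightarrow> i \<le> multiplicity p (Suc n)" for i
    using p by (simp add: power_dvd_iff_le_multiplicity)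
  have "p ^ multiplicity p (Suc n) < p ^ Suc M"
    using Suc.prems dvd_imp_le[OF multiplicity_dvd, of "Suc n" p] by linarith
  hence le: "multiplicity p (Suc n) \<le> M"
    using p by (simp only: power_strict_increasing_iff less_Suc_eq_le)
  have "(\<Sum>i=1..M. Suc n div p ^ i)
      = (\<Sum>i=1..M. n div p ^ i) + (\<Sum>i=1..M. of_bool (i \<le> multiplicity p (Suc n)))"
    by (simp add: div_Suc_indicator dvd_iff sum.distrib)
  also have "(\<Sum>i=1..M. of_bool (i \<le> multiplicity p (Suc n)) :: nat)
      = card ({1..M} \<inter> {i. i \<le> multiplicity p (Suc n)})"
    by (simp add: of_bool_def sum.If_cases)
  also have "{1..M} \<inter> {i. i \<le> multiplicity p (Suc n)} = {1..multiplicity p (Suc n)}"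
    using le by auto
  also have "(\<Sum>i=1..M. n div p ^ i) = multiplicity p (fact n :: nat)"
    using Suc by simp
  also have "multiplicity p (fact n :: nat) + card {1..multiplicity p (Suc n)}
      = multiplicity p (Suc n * fact n)"
    using assms(1) by (subst prime_elem_multiplicity_mult_distrib) auto
  finally show ?case
    by simp
qed

text \<open>By Legendre's formula the multiplicity is the sum of the differences
  \<open>2 * n div p ^ i - 2 * (n div p ^ i)\<close>. Each is at most 1, and there are
  \<open>M\<close> of them with \<open>p ^ M \<le> 2 * n\<close>.\<close>

lemma prime_power_multiplicity_central_binomial_le:
  fixes p n :: nat
  assumes p: "prime p" and n: "n > 0"
  shows "p ^ multiplicity p (2 * n choose n) \<le> 2 * n"
proof -
  have p1: "p > 1" using p by (rule prime_gt_1_nat)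
  obtain M where M: "p ^ M \<le> 2 * n" "2 * n < p ^ Suc M"
    using ex_power_ivl1[of p "2 * n"] p1 n by auto
  have "2 * n div p ^ i \<le> 2 * (n div p ^ i) + 1" for i
  proof -
    have "p ^ i > 0" using p1 by simp
    from dividend_less_div_times[OF this, of n]
    have "2 * n < (2 * (n div p ^ i) + 2) * p ^ i"
      by (simp add: algebra_simps)
    with \<open>p ^ i > 0\<close> have "2 * n div p ^ i < 2 * (n div p ^ i) + 2"
      by (simp only: div_less_iff_less_mult)
    thus ?thesis by simp
  qed
  hence "(\<Sum>i=1..M. 2 * n div p ^ i) \<le> (\<Sum>i=1..M. 2 * (n div p ^ i) + 1)"
    by (intro sum_mono)
  also have "\<dots> = 2 * (\<Sum>i=1..M. n div p ^ i) + M"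
    unfolding sum.distrib by (simp add: sum_distrib_left)
  finally have sum_le: "(\<Sum>i=1..M. 2 * n div p ^ i) \<le> 2 * (\<Sum>i=1..M. n div p ^ i) + M" .
  have "fact (2 * n) = (2 * n choose n) * (fact n * fact n :: nat)"
    using binomial_fact_lemma[of n "2 * n"] by (simp add: mult_2 algebra_simps)
  hence "multiplicity p (fact (2 * n) :: nat)
      = multiplicity p (2 * n choose n) + 2 * multiplicity p (fact n :: nat)"
    using p by (simp add: prime_elem_multiplicity_mult_distrib)
  moreover have "multiplicity p (fact (2 * n) :: nat) = (\<Sum>i=1..M. 2 * n div p ^ i)"
    using p M by (intro multiplicity_fact_eq_sum_div)
  moreover have "multiplicity p (fact n :: nat) = (\<Sum>i=1..M. n div p ^ i)"
    using p M by (intro multiplicity_fact_eq_sum_div) auto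
  ultimately have "multiplicity p (2 * n choose n) \<le> M"
    using sum_le by linarith
  hence "p ^ multiplicity p (2 * n choose n) \<le> p ^ M"
    using p1 by (intro power_increasing) auto
  with M show ?thesis by simp
qed

text \<open>The factorisation contributes at most one factor \<open>2 * n\<close> for each prime up
  to \<open>2 * n\<close>, since every full prime power in it is bounded by
  \<open>2 * n\<close>.\<close>

lemma central_binomial_le_power_primes:
  fixes n :: nat
  assumes n: "n > 0"
  shows "2 * n choose n \<le> (2 * n) ^ card {p. prime p \<and> p \<le> 2 * n}"
proof -
  let ?b = "2 * n choose n"
  have b: "?b \<noteq> 0" by simp
  have sub: "prime_factors ?b \<subseteq> {p. prime p \<and> p \<le> 2 * n}"
  proof
    fix p assume p: "p \<in> prime_factors ?b"
    hence "p ^ 1 \<le> p ^ multiplicity p ?b"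
      by (intro power_increasing) (auto simp: prime_factors_multiplicity prime_ge_Suc_0_nat)
    with p n prime_power_multiplicity_central_binomial_le[of p n]
    show "p \<in> {p. prime p \<and> p \<le> 2 * n}"
      by (auto dest: in_prime_factors_imp_prime)
  qed
  have "?b = (\<Prod>p\<in>prime_factors ?b. p ^ multiplicity p ?b)"
    using b by (simp add: prod_prime_factors)
  also have "\<dots> \<le> (\<Prod>p\<in>prime_factors ?b. 2 * n)"
    using n by (intro prod_mono) (auto intro: prime_power_multiplicity_central_binomial_le)
  also have "\<dots> = (2 * n) ^ card (prime_factors ?b)"
    by simp
  also have "\<dots> \<le> (2 * n) ^ card {p. prime p \<and> p \<le> 2 * n}"
    using n sub by (intro power_increasing card_mono) auto
  finally show ?thesis .
qed

text \<open>Chebyshev's argument: compare with the lower bound \<open>4 ^ n / (2 * n)\<close> for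
  the central binomial coefficient and take logarithms. The added 1 accounts for the denominator
  \<open>2 * n\<close>.\<close>

lemma chebyshev_prime_count_lower:
  fixes n :: nat
  assumes n: "n > 0"
  shows "2 * real n \<le> (real (card {p. prime p \<and> p \<le> 2 * n}) + 1) * log 2 (2 * n)"
proof -
  let ?c = "card {p::nat. prime p \<and> p \<le> 2 * n}"
  have "4 ^ n / (2 * real n) \<le> real (2 * n choose n)"
    using central_binomial_lower_bound[OF n] by simp
  also have "\<dots> \<le> real ((2 * n) ^ ?c)"
    using central_binomial_le_power_primes[OF n] by (simp only: of_nat_le_iff)
  finally have "4 ^ n \<le> (2 * real n) ^ Suc ?c"
    using n by (simp add: divide_le_eq mult.commute)
  moreover have "(4 :: real) ^ n = 2 ^ (2 * n)"
    by (simp add: power_mult)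
  ultimately have "log 2 (2 ^ (2 * n)) \<le> log 2 ((2 * real n) ^ Suc ?c)"
    using n by (subst log_le_cancel_iff) auto
  also have "\<dots> = real (Suc ?c) * log 2 (2 * real n)"
    using n by (intro log_nat_power) auto
  finally show ?thesis
    by (simp add: algebra_simps)
qed

subsection \<open>Fourier analysis modulo Q\<close>

text \<open>The distinct primes dividing \<open>m\<close> have a product of at most
  \<open>\<bar>m\<bar>\<close>, and each of them is at least 2.\<close>

lemma card_prime_divisors_le:
  fixes H :: "nat set" and m :: int
  assumes "finite H" "\<And>q. q \<in> H \<Longrightarrow> prime q" "m \<noteq> 0" "\<bar>m\<bar> < 2 ^ s"
  shows "card {q \<in> H. int q dvd m} \<le> s"
proof -
  let ?P = "{q \<in> H. int q dvd m}" and ?n = "nat \<bar>m\<bar>"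
  have sub: "?P \<subseteq> prime_factors ?n"
    using assms(2,3) by (auto simp: in_prime_factors_iff int_dvd_int_iff[symmetric])
  have "(2::nat) ^ card ?P \<le> 2 ^ card (prime_factors ?n)"
    using sub by (intro power_increasing card_mono) auto
  also have "\<dots> = (\<Prod>p\<in>prime_factors ?n. 2)"
    by simp
  also have "\<dots> \<le> (\<Prod>p\<in>prime_factors ?n. p ^ multiplicity p ?n)"
  proof (intro prod_mono conjI)
    fix p assume p: "p \<in> prime_factors ?n"
    hence "2 \<le> p ^ 1" by (auto dest!: in_prime_factors_imp_prime simp: prime_ge_2_nat)
    also have "p ^ 1 \<le> p ^ multiplicity p ?n"
      using p by (intro power_increasing) (auto simp: prime_factors_multiplicity prime_ge_Suc_0_nat)
    finally show "2 \<le> p ^ multiplicity p ?n" .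
  qed simp
  also have "\<dots> = ?n"
    using assms(3) by (simp add: prod_prime_factors)
  also have "\<dots> < 2 ^ s"
    using assms(4) by (simp add: nat_less_iff)
  finally show ?thesis by simp
qed

text \<open>The additive character of the residues modulo \<open>Q\<close>, taken on integers so
  that negative frequencies and products of a prime and a frequency need no reduction.\<close>

definition root_char :: "nat \<Rightarrow> int \<Rightarrow> complex" where
  "root_char Q k = cis (2 * pi * (of_int k / of_nat Q))"

lemma root_char_add: "root_char Q (a + b) = root_char Q a * root_char Q b"
  by (simp add: root_char_def cis_mult add_divide_distrib distrib_left)

lemma root_char_mult_diff:
  "root_char Q (a * (b - c)) = root_char Q (a * b) * root_char Q (- (a * c))"
  by (simp add: right_diff_distrib flip: root_char_add)

lemma root_char_0 [simp]: "root_char Q 0 = 1"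
  by (simp add: root_char_def)

lemma cnj_root_char: "cnj (root_char Q k) = root_char Q (- k)"
  by (simp add: root_char_def cis_cnj)

lemma root_char_multiple [simp]:
  assumes "Q > 0"
  shows "root_char Q (int Q * k) = 1"
  using assms by (simp add: root_char_def)

lemma root_char_mod:
  assumes "Q > 0"
  shows "root_char Q (k mod int Q) = root_char Q k"
proof -
  have "root_char Q k = root_char Q (int Q * (k div int Q) + k mod int Q)"
    by simp
  thus ?thesis using assms by (simp only: root_char_add root_char_multiple mult_1)
qed

lemma root_char_power: "root_char Q (int n * k) = root_char Q k ^ n"
  by (induction n) (simp_all add: algebra_simps root_char_add)

lemma root_char_eq_1_iff:
  assumes "Q > 0"
  shows "root_char Q k = 1 \<longleftrightarrow> int Q dvd k"
proof
  assume "root_char Q k = 1"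
  then obtain n :: int where "2 * pi * (of_int k / of_nat Q) = of_int (2 * n) * pi"
    by (auto simp: root_char_def cis_conv_exp exp_eq_1)
  hence "real_of_int k = of_int (n * int Q)"
    using assms by (simp add: field_simps)
  hence "k = n * int Q" by (simp only: of_int_eq_iff)
  thus "int Q dvd k" by simp
next
  assume "int Q dvd k"
  thus "root_char Q k = 1" using assms by (auto elim!: dvdE)
qed

text \<open>Orthogonality of characters, as a geometric sum. The window may start at any
  \<open>a\<close>, which later allows the frequencies to be centred at 0.\<close>

lemma sum_root_char:
  assumes "Q > 0"
  shows "(\<Sum>j\<in>{a..<a + int Q}. root_char Q (j * d)) = (if int Q dvd d then of_nat Q else 0)"
proof -
  have "(\<Sum>j\<in>{a..<a + int Q}. root_char Q (j * d)) = (\<Sum>n<Q. root_char Q ((a + int n) * d))"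
    by (rule sum.reindex_bij_witness[of _ "\<lambda>n. a + int n" "\<lambda>j. nat (j - a)"]) auto
  also have "\<dots> = root_char Q (a * d) * (\<Sum>n<Q. root_char Q d ^ n)"
    by (simp add: distrib_right root_char_add root_char_power sum_distrib_left)
  also have "\<dots> = (if int Q dvd d then of_nat Q else 0)"
  proof (cases "int Q dvd d")
    case True
    hence "root_char Q d = 1" "root_char Q (a * d) = 1"
      using assms by (simp_all add: root_char_eq_1_iff)
    with True show ?thesis by simp
  next
    case False
    hence "root_char Q d \<noteq> 1" using assms by (simp add: root_char_eq_1_iff)
    moreover have "root_char Q d ^ Q = 1" using assms by (simp flip: root_char_power)
    ultimately show ?thesis using False by (simp add: sum_gp_strict)
  qed
  finally show ?thesis .
qed

text \<open>Expanding the square and summing over \<open>j\<close> first leaves only the diagonal.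
  The labelling \<open>\<phi>\<close> lets the identity serve both for plain frequencies and for
  their dilates by a prime.\<close>

lemma root_char_parseval:
  fixes \<phi> :: "'a \<Rightarrow> int"
  assumes Q: "Q > 0" and F: "finite F"
    and inj: "\<And>x y. x \<in> F \<Longrightarrow> y \<in> F \<Longrightarrow> int Q dvd \<phi> x - \<phi> y \<Longrightarrow> x = y"
  shows "(\<Sum>j\<in>{0..<int Q}. (norm (\<Sum>x\<in>F. c x * root_char Q (\<phi> x * j)))\<^sup>2)
       = real Q * (\<Sum>x\<in>F. (norm (c x))\<^sup>2)"
proof -
  let ?e = "\<lambda>x y j. root_char Q (j * (\<phi> x - \<phi> y))"
  have "complex_of_real (\<Sum>j\<in>{0..<int Q}. (norm (\<Sum>x\<in>F. c x * root_char Q (\<phi> x * j)))\<^sup>2)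
     = (\<Sum>j\<in>{0..<int Q}. \<Sum>x\<in>F. \<Sum>y\<in>F. c x * cnj (c y) * ?e x y j)"
    unfolding of_real_sum complex_norm_square cnj_sum sum_product
    by (intro sum.cong refl) (simp add: root_char_mult_diff cnj_root_char mult_ac)
  also have "\<dots> = (\<Sum>x\<in>F. \<Sum>j\<in>{0..<int Q}. \<Sum>y\<in>F. c x * cnj (c y) * ?e x y j)"
    by (rule sum.swap)
  also have "\<dots> = (\<Sum>x\<in>F. \<Sum>y\<in>F. c x * cnj (c y) * (\<Sum>j\<in>{0..<int Q}. ?e x y j))"
    unfolding sum_distrib_left by (intro sum.cong refl sum.swap)
  also have "\<dots> = (\<Sum>x\<in>F. \<Sum>y\<in>F. if y = x then c x * cnj (c x) * of_nat Q else 0)"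
  proof (intro sum.cong refl)
    fix x y assume "x \<in> F" "y \<in> F"
    thus "c x * cnj (c y) * (\<Sum>j\<in>{0..<int Q}. ?e x y j)
        = (if y = x then c x * cnj (c x) * of_nat Q else 0)"
      using inj[of x y] sum_root_char[OF Q, where a = 0 and d = "\<phi> x - \<phi> y"]
      by (cases "int Q dvd \<phi> x - \<phi> y") auto
  qed
  also have "\<dots> = complex_of_real (real Q * (\<Sum>x\<in>F. (norm (c x))\<^sup>2))"
    using F by (simp add: complex_norm_square sum_distrib_left mult_ac del: of_real_power)
  finally show ?thesis by (simp only: of_real_eq_iff)
qed

text \<open>The factor \<open>1 / Q\<close> sits on the forward transform, so the coefficient at 0
  of an indicator function is its density and inversion carries no factor.\<close>

definition dft :: "nat \<Rightarrow> (int \<Rightarrow> complex) \<Rightarrow> int \<Rightarrow> complex" where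
  "dft Q g k = (\<Sum>i\<in>{0..<int Q}. g i * root_char Q (- (k * i))) / of_nat Q"

lemma dft_inversion:
  assumes Q: "Q > 0" and j: "j \<in> {0..<int Q}"
  shows "(\<Sum>k\<in>{a..<a + int Q}. dft Q g k * root_char Q (k * j)) = g j"
proof -
  have "(\<Sum>k\<in>{a..<a + int Q}. dft Q g k * root_char Q (k * j))
     = (\<Sum>k\<in>{a..<a + int Q}. \<Sum>i\<in>{0..<int Q}. g i / of_nat Q * root_char Q (k * (j - i)))"
    unfolding dft_def sum_divide_distrib sum_distrib_right
    by (intro sum.cong refl) (simp add: root_char_mult_diff mult_ac)
  also have "\<dots> = (\<Sum>i\<in>{0..<int Q}. g i / of_nat Q * (\<Sum>k\<in>{a..<a + int Q}. root_char Q (k * (j - i))))"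
    unfolding sum_distrib_left by (rule sum.swap)
  also have "\<dots> = (\<Sum>i\<in>{0..<int Q}. if i = j then g i else 0)"
  proof (intro sum.cong refl)
    fix i assume i: "i \<in> {0..<int Q}"
    have "int Q dvd j - i \<longleftrightarrow> i = j"
      using i j dvd_imp_le_int[of "j - i" "int Q"] by (cases "i = j") auto
    thus "g i / of_nat Q * (\<Sum>k\<in>{a..<a + int Q}. root_char Q (k * (j - i))) = (if i = j then g i else 0)"
      using Q by (simp add: sum_root_char)
  qed
  also have "\<dots> = g j" using j by simp
  finally show ?thesis .
qed

text \<open>Taylor expansion: for \<open>\<bar>x\<bar> \<le> 2\<close> the cubic remainder is at
  most two thirds of \<open>\<bar>x\<bar>\<close>.\<close>

lemma third_le_abs_sin:
  fixes x :: real
  assumes "\<bar>x\<bar> \<le> pi / 2"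
  shows "\<bar>x\<bar> / 3 \<le> \<bar>sin x\<bar>"
proof -
  have "\<bar>x\<bar> \<le> 2" using assms pi_less_4 by simp
  hence "\<bar>x\<bar> ^ 2 \<le> 2 ^ 2" by (intro power_mono) auto
  hence "\<bar>x\<bar> * \<bar>x\<bar> ^ 2 \<le> \<bar>x\<bar> * 4" by (intro mult_left_mono) auto
  hence "\<bar>x\<bar> ^ 3 \<le> 4 * \<bar>x\<bar>" by (simp add: eval_nat_numeral)
  moreover have "\<bar>sin x - x\<bar> \<le> \<bar>x\<bar> ^ 3 / 6"
    using Maclaurin_sin_bound[of x 3]
    by (simp add: eval_nat_numeral sin_coeff_def fact_reduce field_simps)
  ultimately show ?thesis by linarith
qed

text \<open>The left-out angle is halved: the norm equals twice the absolute value of the sine of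
  \<open>pi * k / Q\<close>. The inequality \<open>pi > 3\<close> then cancels the third lost in the
  sine bound.\<close>

lemma norm_root_char_minus_1_ge:
  assumes "Q > 0" "2 * \<bar>k\<bar> \<le> int Q"
  shows "2 * \<bar>real_of_int k\<bar> / Q \<le> norm (root_char Q k - 1)"
proof -
  let ?x = "pi * k / Q"
  have "real_of_int (2 * \<bar>k\<bar>) \<le> real_of_int (int Q)"
    using assms(2) by (simp only: of_int_le_iff)
  hence "\<bar>?x\<bar> \<le> pi / 2"
    using assms(1) by (simp add: abs_mult field_simps)
  hence "\<bar>?x\<bar> / 3 \<le> \<bar>sin ?x\<bar>"
    by (rule third_le_abs_sin)
  moreover have "2 * \<bar>real_of_int k\<bar> / Q \<le> 2 * (\<bar>?x\<bar> / 3)"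
    using mult_right_mono[OF less_imp_le[OF pi_gt3], of "\<bar>real_of_int k\<bar>"] assms(1)
    by (simp add: abs_mult field_simps)
  moreover have "norm (root_char Q k - 1) = 2 * \<bar>sin ?x\<bar>"
  proof -
    have "(norm (root_char Q k - 1))\<^sup>2 = (cos (2 * ?x) - 1)\<^sup>2 + (sin (2 * ?x))\<^sup>2"
      by (simp add: root_char_def cmod_power2 mult_ac)
    also have "\<dots> = (2 * \<bar>sin ?x\<bar>)\<^sup>2"
      using sin_cos_squared_add[of ?x] unfolding sin_double cos_double_sin
      by (simp add: power2_eq_square) algebra
    finally show ?thesis
      by (rule power2_eq_imp_eq) auto
  qed
  ultimately show ?thesis by linarith
qed

section \<open>Second moment of the number of prime dilates that hit a set of residues\<close>

lemma norm_sum_squared_le: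
  fixes f :: "'a \<Rightarrow> complex"
  shows "(norm (\<Sum>x\<in>S. f x))\<^sup>2 \<le> real (card S) * (\<Sum>x\<in>S. (norm (f x))\<^sup>2)"
proof -
  have "(norm (\<Sum>x\<in>S. f x))\<^sup>2 \<le> (\<Sum>x\<in>S. norm (f x))\<^sup>2"
    by (intro power_mono norm_sum) auto
  also have "\<dots> \<le> real (card S) * (\<Sum>x\<in>S. (norm (f x))\<^sup>2)"
    using sum_squared_le_sum_of_squares[of "\<lambda>x. norm (f x)" S] by (simp add: mult.commute)
  finally show ?thesis .
qed

text \<open>Cauchy-Schwarz over \<open>q\<close> costs a factor \<open>card H\<close>.
  Multiplication by \<open>q\<close> is injective modulo \<open>Q\<close>, so each inner sum keeps
  its energy by Parseval. The loss is affordable because this is applied to frequencies that carry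
  little energy.\<close>

lemma high_frequency_bound:
  assumes Q: "Q > 0" and X: "finite X"
    and H: "\<And>q. q \<in> H \<Longrightarrow> coprime (int q) (int Q)"
    and inj: "\<And>x y. x \<in> X \<Longrightarrow> y \<in> X \<Longrightarrow> int Q dvd x - y \<Longrightarrow> x = y"
  shows "(\<Sum>j\<in>{0..<int Q}. (norm (\<Sum>q\<in>H. \<Sum>k\<in>X. c k * root_char Q (k * (int q * j))))\<^sup>2)
       \<le> real (card H) ^ 2 * real Q * (\<Sum>k\<in>X. (norm (c k))\<^sup>2)"
proof -
  have *: "(\<Sum>j\<in>{0..<int Q}. (norm (\<Sum>k\<in>X. c k * root_char Q (k * (int q * j))))\<^sup>2)
      = real Q * (\<Sum>k\<in>X. (norm (c k))\<^sup>2)" if "q \<in> H" for q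
    unfolding mult.assoc[symmetric]
  proof (rule root_char_parseval[OF Q X, unfolded mult.assoc[symmetric]])
    fix x y assume "x \<in> X" "y \<in> X" "int Q dvd x * int q - y * int q"
    moreover from this H[OF that] have "int Q dvd x - y"
      by (simp add: coprime_dvd_mult_left_iff coprime_commute flip: left_diff_distrib)
    ultimately show "x = y" using inj by blast
  qed
  have "(\<Sum>j\<in>{0..<int Q}. (norm (\<Sum>q\<in>H. \<Sum>k\<in>X. c k * root_char Q (k * (int q * j))))\<^sup>2)
     \<le> (\<Sum>j\<in>{0..<int Q}. real (card H) *
          (\<Sum>q\<in>H. (norm (\<Sum>k\<in>X. c k * root_char Q (k * (int q * j))))\<^sup>2))"
    by (intro sum_mono norm_sum_squared_le)
  also have "\<dots> = real (card H) *
      (\<Sum>q\<in>H. \<Sum>j\<in>{0..<int Q}. (norm (\<Sum>k\<in>X. c k * root_char Q (k * (int q * j))))\<^sup>2)"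
    unfolding sum_distrib_left[symmetric] by (subst sum.swap) (rule refl)
  also have "\<dots> = real (card H) ^ 2 * real Q * (\<Sum>k\<in>X. (norm (c k))\<^sup>2)"
    by (simp add: * power2_eq_square[of "real (card H)"])
  finally show ?thesis .
qed

text \<open>A frequency \<open>m\<close> arises as \<open>q * k\<close> from at most \<open>s\<close> primes \<open>q\<close>; restricting to prime
  dilations thus replaces the divisor function by a logarithm.\<close>

lemma low_frequency_bound:
  assumes Q: "Q > 0" and X: "finite X" and H: "finite H" "\<And>q. q \<in> H \<Longrightarrow> prime q"
    and small: "\<And>q k. q \<in> H \<Longrightarrow> k \<in> X \<Longrightarrow> k \<noteq> 0 \<and> \<bar>int q * k\<bar> < 2 ^ s \<and> 2 * \<bar>int q * k\<bar> < int Q"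
  shows "(\<Sum>j\<in>{0..<int Q}. (norm (\<Sum>q\<in>H. \<Sum>k\<in>X. c k * root_char Q (k * (int q * j))))\<^sup>2)
       \<le> real s * real (card H) * real Q * (\<Sum>k\<in>X. (norm (c k))\<^sup>2)"
proof -
  define \<phi> where "\<phi> = (\<lambda>(q, k). int q * k)"
  define F where "F = \<phi> ` (H \<times> X)"
  define fib where "fib m = {p \<in> H \<times> X. \<phi> p = m}" for m
  define a where "a m = (\<Sum>p\<in>fib m. c (snd p))" for m
  have F: "finite F" unfolding F_def using X H by simp
  have fin: "finite (H \<times> X)" using X H by simp
  have F_small: "m \<noteq> 0" "\<bar>m\<bar> < 2 ^ s" "2 * \<bar>m\<bar> < int Q" if "m \<in> F" for m
  proof -
    from that obtain q k where "q \<in> H" "k \<in> X" "m = int q * k"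
      unfolding F_def \<phi>_def by auto
    with small[of q k] H(2)[of q] show "m \<noteq> 0" "\<bar>m\<bar> < 2 ^ s" "2 * \<bar>m\<bar> < int Q"
      by (auto simp: prime_gt_0_nat)
  qed
  have card_fib: "card (fib m) \<le> s" if m: "m \<in> F" for m
  proof -
    \<comment> \<open>As \<open>m\<close> is nonzero, \<open>q\<close> and \<open>m = q * k\<close>
      determine \<open>k\<close>. Counting representations thus reduces to counting prime divisors
      of \<open>m\<close>.\<close>
    have "inj_on fst (fib m)"
      using F_small(1)[OF m] by (auto simp: inj_on_def fib_def \<phi>_def)
    moreover have "fst ` fib m \<subseteq> {q \<in> H. int q dvd m}"
      by (auto simp: fib_def \<phi>_def)
    ultimately have "card (fib m) \<le> card {q \<in> H. int q dvd m}"
      using H(1) by (intro card_inj_on_le) auto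
    also have "\<dots> \<le> s"
      using F_small[OF m] H by (intro card_prime_divisors_le) auto
    finally show ?thesis .
  qed
  have "(\<Sum>q\<in>H. \<Sum>k\<in>X. c k * root_char Q (k * (int q * j))) = (\<Sum>m\<in>F. a m * root_char Q (m * j))" for j
  proof -
    have "(\<Sum>q\<in>H. \<Sum>k\<in>X. c k * root_char Q (k * (int q * j)))
        = (\<Sum>p\<in>H \<times> X. c (snd p) * root_char Q (\<phi> p * j))"
      by (simp add: sum.cartesian_product \<phi>_def case_prod_unfold mult_ac)
    also have "\<dots> = (\<Sum>m\<in>F. \<Sum>p\<in>fib m. c (snd p) * root_char Q (\<phi> p * j))"
      unfolding F_def fib_def by (rule sum.image_gen[OF fin])
    also have "\<dots> = (\<Sum>m\<in>F. a m * root_char Q (m * j))"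
      unfolding a_def sum_distrib_right by (intro sum.cong refl) (auto simp: fib_def)
    finally show ?thesis .
  qed
  hence eq: "(\<Sum>j\<in>{0..<int Q}. (norm (\<Sum>q\<in>H. \<Sum>k\<in>X. c k * root_char Q (k * (int q * j))))\<^sup>2)
      = real Q * (\<Sum>m\<in>F. (norm (a m))\<^sup>2)"
  proof (simp only:, intro root_char_parseval[OF Q F])
    \<comment> \<open>All products lie strictly within \<open>Q / 2\<close> of 0, so distinct ones
      stay distinct modulo \<open>Q\<close>.\<close>
    fix x y assume xy: "x \<in> F" "y \<in> F" "int Q dvd x - y"
    show "x = y"
      using F_small(3)[OF xy(1)] F_small(3)[OF xy(2)] xy(3)
        dvd_imp_le_int[of "x - y" "int Q"] by (cases "x = y") auto
  qed
  have "(\<Sum>m\<in>F. (norm (a m))\<^sup>2) \<le> (\<Sum>m\<in>F. real s * (\<Sum>p\<in>fib m. (norm (c (snd p)))\<^sup>2))"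
  proof (intro sum_mono)
    fix m assume m: "m \<in> F"
    have "(norm (a m))\<^sup>2 \<le> real (card (fib m)) * (\<Sum>p\<in>fib m. (norm (c (snd p)))\<^sup>2)"
      unfolding a_def by (rule norm_sum_squared_le)
    also have "\<dots> \<le> real s * (\<Sum>p\<in>fib m. (norm (c (snd p)))\<^sup>2)"
      using card_fib[OF m] by (intro mult_right_mono sum_nonneg) auto
    finally show "(norm (a m))\<^sup>2 \<le> real s * (\<Sum>p\<in>fib m. (norm (c (snd p)))\<^sup>2)" .
  qed
  also have "\<dots> = real s * (\<Sum>p\<in>H \<times> X. (norm (c (snd p)))\<^sup>2)"
    unfolding sum_distrib_left[symmetric] F_def fib_def by (subst sum.image_gen[OF fin, of _ \<phi>]) (rule refl)
  also have "(\<Sum>p\<in>H \<times> X. (norm (c (snd p)))\<^sup>2) = real (card H) * (\<Sum>k\<in>X. (norm (c k))\<^sup>2)"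
    by (simp add: sum.cartesian_product[symmetric] case_prod_unfold[symmetric] sum.cartesian_product')
  finally have "(\<Sum>m\<in>F. (norm (a m))\<^sup>2) \<le> real s * (real (card H) * (\<Sum>k\<in>X. (norm (c k))\<^sup>2))" .
  hence "real Q * (\<Sum>m\<in>F. (norm (a m))\<^sup>2)
      \<le> real Q * (real s * (real (card H) * (\<Sum>k\<in>X. (norm (c k))\<^sup>2)))"
    by (intro mult_left_mono) auto
  thus ?thesis unfolding eq by (simp only: mult_ac)
qed


text \<open>A Chebyshev inequality: at a bad \<open>j\<close> the full Fourier sum over
  \<open>q\<close> vanishes, so the nonzero frequencies must cancel the main term
  \<open>card H * \<rho>\<close>. The first term on the right comes from frequencies up to
  \<open>K\<close>, the second from those above \<open>K\<close>, whose energy is controlled by the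
  number of boundary points of \<open>G\<close>.\<close>

lemma bad_residues_bound:
  fixes G :: "int set" and H :: "nat set" and M N K s b :: nat
  defines "Q \<equiv> 2 * M"
  defines "\<rho> \<equiv> real (card G) / real Q"
  assumes M: "M > 0" and K: "K > 0" and G: "G \<subseteq> {0..<int Q}"
    and H: "finite H" "\<And>q. q \<in> H \<Longrightarrow> prime q \<and> q \<le> N \<and> coprime q Q"
    and NK: "N * K < M" "N * K < 2 ^ s"
    and b: "card {j \<in> {0..<int Q}. (j \<in> G) \<noteq> ((j + 1) mod int Q \<in> G)} \<le> b"
  shows "real (card {j \<in> {0..<int Q}. \<forall>q\<in>H. (int q * j) mod int Q \<notin> G}) * (real (card H) * \<rho>)\<^sup>2
    \<le> 2 * real s * real (card H) * real Q * \<rho> + (real (card H) * real Q)\<^sup>2 * real b / (2 * real K ^ 2)"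
proof -
  define g :: "int \<Rightarrow> complex" where "g i = of_bool (i \<in> G)" for i
  define c where "c = dft Q g"
  \<comment> \<open>With \<open>Q = 2 * M\<close> this window is \<open>[-M, M)\<close>, so
    \<open>2 * \<bar>k\<bar> \<le> Q\<close> throughout, as the lower bound for
    \<open>root_char Q k - 1\<close> requires.\<close>
  define Z where "Z = {- int M..<- int M + int Q}"
  define lo where "lo = {k \<in> Z. k \<noteq> 0 \<and> \<bar>k\<bar> \<le> int K}"
  define hi where "hi = {k \<in> Z. int K < \<bar>k\<bar>}"
  define bad where "bad = {j \<in> {0..<int Q}. \<forall>q\<in>H. (int q * j) mod int Q \<notin> G}"
  define S where "S X j = (\<Sum>q\<in>H. \<Sum>k\<in>X. c k * root_char Q (k * (int q * j)))" for X j
  have Q: "Q > 0" using M by (simp add: Q_def)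
  have finG: "finite G" using G finite_subset by blast
  have "finite Z" by (simp add: Z_def)
  hence fin: "finite Z" "finite lo" "finite hi" by (simp_all add: lo_def hi_def)
  have inj: "x = y" if "x \<in> Z" "y \<in> Z" "int Q dvd x - y" for x y
    using that dvd_imp_le_int[of "x - y" "int Q"] by (cases "x = y") (auto simp: Z_def)
  have inversion: "(\<Sum>k\<in>Z. c k * root_char Q (k * j)) = g (j mod int Q)" for j
  proof -
    have "root_char Q (k * j) = root_char Q (k * (j mod int Q))" for k
      using root_char_mod[OF Q, of "k * j"] root_char_mod[OF Q, of "k * (j mod int Q)"]
      by (simp add: mod_mult_right_eq)
    thus ?thesis
      using dft_inversion[OF Q, where j = "j mod int Q" and a = "- int M" and g = g] Q by (simp add: Z_def c_def)
  qed
  have c0: "c 0 = of_real \<rho>"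
    using G by (simp add: c_def dft_def g_def \<rho>_def of_bool_def sum.If_cases Int_absorb1)
  have energy: "(\<Sum>k\<in>Z. (norm (c k))\<^sup>2) = \<rho>"
  proof -
    have "real Q * (\<Sum>k\<in>Z. (norm (c k))\<^sup>2) = (\<Sum>j\<in>{0..<int Q}. (norm (g j))\<^sup>2)"
      using root_char_parseval[OF Q fin(1), of "\<lambda>k. k" c] inj by (simp add: inversion)
    also have "\<dots> = (\<Sum>j\<in>{0..<int Q}. of_bool (j \<in> G))"
      by (intro sum.cong) (auto simp: g_def)
    also have "\<dots> = real (card G)"
      using G by (simp add: of_bool_def sum.If_cases Int_absorb1)
    finally show ?thesis using Q by (simp add: \<rho>_def field_simps)
  qed
  \<comment> \<open>Multiplying the coefficients by \<open>root_char Q k - 1\<close> corresponds to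
    the forward difference of \<open>g\<close>, whose square is the indicator of the boundary
    points. Parseval turns their number into weighted energy.\<close>
  have "real Q * (\<Sum>k\<in>Z. (norm (c k * (root_char Q k - 1)))\<^sup>2)
      = (\<Sum>j\<in>{0..<int Q}. (norm (\<Sum>k\<in>Z. c k * (root_char Q k - 1) * root_char Q (k * j)))\<^sup>2)"
    using inj by (intro root_char_parseval[OF Q fin(1), symmetric]) auto
  also have "\<dots> = (\<Sum>j\<in>{0..<int Q}. (norm (g ((j + 1) mod int Q) - g j))\<^sup>2)"
  proof (intro sum.cong refl)
    fix j assume j: "j \<in> {0..<int Q}"
    have "(\<Sum>k\<in>Z. c k * (root_char Q k - 1) * root_char Q (k * j))
        = (\<Sum>k\<in>Z. c k * root_char Q (k * (j + 1))) - (\<Sum>k\<in>Z. c k * root_char Q (k * j))"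
      by (simp add: distrib_left root_char_add algebra_simps sum_subtractf)
    thus "(norm (\<Sum>k\<in>Z. c k * (root_char Q k - 1) * root_char Q (k * j)))\<^sup>2
        = (norm (g ((j + 1) mod int Q) - g j))\<^sup>2"
      using j by (simp add: inversion)
  qed
  also have "\<dots> = (\<Sum>j\<in>{0..<int Q}. of_bool ((j \<in> G) \<noteq> ((j + 1) mod int Q \<in> G)))"
    by (intro sum.cong) (auto simp: g_def)
  also have "\<dots> = real (card {j \<in> {0..<int Q}. (j \<in> G) \<noteq> ((j + 1) mod int Q \<in> G)})"
    by (simp only: of_bool_def sum.If_cases finite_atLeastLessThan_int Int_def mem_Collect_eq) simp
  also have "\<dots> \<le> real b" using b by simp
  finally have diff: "real Q * (\<Sum>k\<in>Z. (norm (c k * (root_char Q k - 1)))\<^sup>2) \<le> real b" .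
  \<comment> \<open>On \<open>hi\<close> the weight is at least the square of
    \<open>2 * K / Q\<close>, so the weighted bound yields one for the plain energy.\<close>
  have "(2 * real K / Q)\<^sup>2 * (\<Sum>k\<in>hi. (norm (c k))\<^sup>2)
      \<le> (\<Sum>k\<in>hi. (norm (c k * (root_char Q k - 1)))\<^sup>2)"
    unfolding sum_distrib_left
  proof (intro sum_mono)
    fix k assume k: "k \<in> hi"
    have "2 * real K / Q \<le> 2 * \<bar>real_of_int k\<bar> / Q"
      using k by (intro divide_right_mono) (auto simp: hi_def)
    also have "\<dots> \<le> norm (root_char Q k - 1)"
      using k Q by (intro norm_root_char_minus_1_ge) (auto simp: hi_def Z_def Q_def)
    finally have "(2 * real K / Q)\<^sup>2 \<le> (norm (root_char Q k - 1))\<^sup>2"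
      by (intro power_mono) auto
    thus "(2 * real K / Q)\<^sup>2 * (norm (c k))\<^sup>2 \<le> (norm (c k * (root_char Q k - 1)))\<^sup>2"
      unfolding norm_mult power_mult_distrib by (subst mult.commute) (intro mult_left_mono, auto)
  qed
  also have "\<dots> \<le> (\<Sum>k\<in>Z. (norm (c k * (root_char Q k - 1)))\<^sup>2)"
    using fin by (intro sum_mono2) (auto simp: hi_def)
  also have "\<dots> \<le> real b / Q"
    using diff Q by (simp add: field_simps)
  finally have hi_energy: "(\<Sum>k\<in>hi. (norm (c k))\<^sup>2) \<le> real b * Q / (4 * real K ^ 2)"
    using Q K by (simp add: field_simps power2_eq_square)
  have "(\<Sum>k\<in>lo. (norm (c k))\<^sup>2) \<le> \<rho>"
    unfolding energy[symmetric] using fin by (intro sum_mono2) (auto simp: lo_def)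
  hence "real s * real (card H) * real Q * (\<Sum>k\<in>lo. (norm (c k))\<^sup>2) \<le> real s * real (card H) * real Q * \<rho>"
    by (intro mult_left_mono) auto
  moreover have "(\<Sum>j\<in>{0..<int Q}. (norm (S lo j))\<^sup>2)
      \<le> real s * real (card H) * real Q * (\<Sum>k\<in>lo. (norm (c k))\<^sup>2)"
    unfolding S_def
  proof (intro low_frequency_bound Q fin H(1))
    fix q k assume q: "q \<in> H" and k: "k \<in> lo"
    have "\<bar>int q * k\<bar> \<le> int N * int K"
      using H(2)[OF q] k unfolding abs_mult by (intro mult_mono) (auto simp: lo_def)
    also have "\<dots> = int (N * K)" by simp
    finally have "\<bar>int q * k\<bar> \<le> int (N * K)" .
    moreover have "int (N * K) < int M" "int (N * K) < int (2 ^ s)"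
      using NK by (simp_all only: of_nat_less_iff)
    ultimately show "k \<noteq> 0 \<and> \<bar>int q * k\<bar> < 2 ^ s \<and> 2 * \<bar>int q * k\<bar> < int Q"
      using k by (auto simp: lo_def Q_def)
  qed (use H(2) in auto)
  ultimately have lo: "(\<Sum>j\<in>{0..<int Q}. (norm (S lo j))\<^sup>2) \<le> real s * real (card H) * real Q * \<rho>"
    by linarith
  have "(\<Sum>j\<in>{0..<int Q}. (norm (S hi j))\<^sup>2)
      \<le> real (card H) ^ 2 * real Q * (\<Sum>k\<in>hi. (norm (c k))\<^sup>2)"
    unfolding S_def using H(2) inj
    by (intro high_frequency_bound Q fin) (auto simp: hi_def coprime_int_iff)
  also have "\<dots> \<le> real (card H) ^ 2 * real Q * (real b * Q / (4 * real K ^ 2))"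
    using hi_energy by (intro mult_left_mono) auto
  finally have hi: "(\<Sum>j\<in>{0..<int Q}. (norm (S hi j))\<^sup>2)
      \<le> (real (card H) * real Q)\<^sup>2 * real b / (4 * real K ^ 2)"
    by (simp add: power2_eq_square mult_ac)
  have "real (card bad) * (real (card H) * \<rho>)\<^sup>2 = (\<Sum>j\<in>bad. (real (card H) * \<rho>)\<^sup>2)"
    by simp
  also have "\<dots> \<le> (\<Sum>j\<in>bad. 2 * (norm (S lo j))\<^sup>2 + 2 * (norm (S hi j))\<^sup>2)"
  proof (intro sum_mono)
    fix j assume j: "j \<in> bad"
    have Z_eq: "Z = insert 0 (lo \<union> hi)" and disj: "0 \<notin> lo \<union> hi" "lo \<inter> hi = {}"
      using M by (auto simp: lo_def hi_def Z_def Q_def)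
    \<comment> \<open>By inversion the inner sum is \<open>g\<close> at the residue of
      \<open>q * j\<close>, which is 0 for every \<open>q\<close> when \<open>j\<close> is
      bad.\<close>
    have "0 = (\<Sum>q\<in>H. \<Sum>k\<in>Z. c k * root_char Q (k * (int q * j)))"
      using j by (simp add: inversion bad_def g_def)
    also have "\<dots> = (\<Sum>q\<in>H. c 0 + ((\<Sum>k\<in>lo. c k * root_char Q (k * (int q * j)))
        + (\<Sum>k\<in>hi. c k * root_char Q (k * (int q * j)))))"
      unfolding Z_eq using fin disj by (simp add: sum.union_disjoint)
    also have "\<dots> = of_real (real (card H) * \<rho>) + (S lo j + S hi j)"
      by (simp add: sum.distrib S_def c0)
    finally have "of_real (real (card H) * \<rho>) = - (S lo j + S hi j)"
      by (simp only: eq_neg_iff_add_eq_0)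
    hence "norm (complex_of_real (real (card H) * \<rho>)) = norm (S lo j + S hi j)"
      by (simp only: norm_minus_cancel)
    hence "(real (card H) * \<rho>)\<^sup>2 = (norm (S lo j + S hi j))\<^sup>2"
      by (simp only: norm_of_real) (metis power2_abs)
    also have "\<dots> \<le> (norm (S lo j) + norm (S hi j))\<^sup>2"
      by (intro power_mono norm_triangle_ineq) auto
    also have "\<dots> \<le> 2 * (norm (S lo j))\<^sup>2 + 2 * (norm (S hi j))\<^sup>2"
      using sum_squares_ge_zero[of "norm (S lo j) - norm (S hi j)" 0]
      by (simp add: power2_eq_square algebra_simps)
    finally show "(real (card H) * \<rho>)\<^sup>2 \<le> 2 * (norm (S lo j))\<^sup>2 + 2 * (norm (S hi j))\<^sup>2" .
  qed
  also have "\<dots> \<le> (\<Sum>j\<in>{0..<int Q}. 2 * (norm (S lo j))\<^sup>2 + 2 * (norm (S hi j))\<^sup>2)"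
    by (intro sum_mono2) (auto simp: bad_def)
  also have "\<dots> = 2 * (\<Sum>j\<in>{0..<int Q}. (norm (S lo j))\<^sup>2) + 2 * (\<Sum>j\<in>{0..<int Q}. (norm (S hi j))\<^sup>2)"
    by (simp add: sum.distrib sum_distrib_left)
  finally show ?thesis
    using lo hi unfolding bad_def by simp
qed

subsection \<open>Discretisation\<close>

text \<open>The window has length \<open>N / Q\<close> rather than \<open>1 / Q\<close> because
  rounding the rotation angle down to the grid moves its multiple by \<open>h \<le> N\<close> by
  less than \<open>N / Q\<close>.\<close>

definition grid_inside :: "nat \<Rightarrow> nat \<Rightarrow> real set \<Rightarrow> int set" where
  "grid_inside Q N I = {i \<in> {0..<int Q}. {of_int i / real Q..<(of_int i + real N) / real Q} \<subseteq> I}"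

lemma finite_grid_inside [simp]: "finite (grid_inside Q N I)"
  by (rule finite_subset[of _ "{0..<int Q}"]) (auto simp: grid_inside_def)

lemma grid_inside_convex:
  assumes I: "is_interval I" and Q: "Q > 0" and "i \<in> grid_inside Q N I" "k \<in> grid_inside Q N I"
    and "i \<le> j" "j \<le> k" and N: "N > 0"
  shows "j \<in> grid_inside Q N I"
proof -
  have ij: "real_of_int i / Q \<le> j / Q" and jk: "(real_of_int j + N) / Q \<le> (k + N) / Q"
    using assms by (simp_all add: divide_right_mono)
  have "x \<in> I" if x: "j / Q \<le> x" "x < (real_of_int j + N) / Q" for x
  proof -
    have "i / Q \<in> {of_int i / real Q..<(of_int i + real N) / real Q}"
      using Q N by (simp add: divide_strict_right_mono)
    hence "i / Q \<in> I" using assms(3) unfolding grid_inside_def by blast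
    \<comment> \<open>The maximum is needed since \<open>x\<close> may lie to the right of
      \<open>k / Q\<close>; it still lies in the window of \<open>k\<close>.\<close>
    moreover have "max x (k / Q) \<in> {of_int k / real Q..<(of_int k + real N) / real Q}"
      using x jk Q N by (auto simp: divide_strict_right_mono)
    hence "max x (k / Q) \<in> I" using assms(4) unfolding grid_inside_def by blast
    moreover have "i / Q \<le> x" "x \<le> max x (k / Q)" using ij x by auto
    ultimately show ?thesis using I unfolding is_interval_1 by blast
  qed
  thus ?thesis using assms by (auto simp: grid_inside_def)
qed

lemma card_grid_inside_ge:
  assumes I: "is_interval I" "I \<subseteq> {0..<1}" and Q: "Q > 0" and N: "N > 0"
  shows "real (card (grid_inside Q N I)) \<ge> real Q * measure lebesgue I - (real N + 1)"
proof (cases "I = {}")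
  case True
  thus ?thesis by simp
next
  case False
  define a b where "a = Inf I" and "b = Sup I"
  have bdd: "bdd_below I" "bdd_above I"
    using I(2) by (auto intro!: bdd_belowI[of _ 0] bdd_aboveI[of _ 1])
  have a0: "a \<ge> 0" unfolding a_def using False I(2) by (intro cInf_greatest) auto
  have b1: "b \<le> 1" unfolding b_def using False I(2) by (intro cSup_least) auto
  have sub: "I \<subseteq> {a..b}"
    using bdd by (auto simp: a_def b_def intro: cInf_lower cSup_upper)
  have sup: "x \<in> I" if x: "a < x" "x < b" for x
  proof -
    obtain u where "u \<in> I" "u < x"
      using x(1) cInf_less_iff[OF False bdd(1), of x] by (auto simp: a_def)
    moreover obtain v where "v \<in> I" "x < v"
      using x(2) less_cSup_iff[OF False bdd(2), of x] by (auto simp: b_def)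
    ultimately show ?thesis using I(1) unfolding is_interval_1 by (meson less_imp_le)
  qed
  have ab: "a \<le> b" using False sub by auto
  have "I \<in> sets lebesgue"
    using I(1) by (intro sets_completionI_sets) (simp add: real_interval_borel_measurable)
  hence "measure lebesgue I \<le> measure lebesgue {a..b}"
    using sub by (intro measure_mono_fmeasurable) auto
  hence meas: "measure lebesgue I \<le> b - a" using ab by simp
  \<comment> \<open>The left end makes \<open>i / Q\<close> strictly larger than \<open>a\<close>,
    which need not belong to \<open>I\<close>. The right end leaves room for a half-open window
    below \<open>b\<close>.\<close>
  have "{\<lfloor>Q * a\<rfloor> + 1..\<lfloor>Q * b\<rfloor> - int N} \<subseteq> grid_inside Q N I"
  proof
    fix i assume i: "i \<in> {\<lfloor>Q * a\<rfloor> + 1..\<lfloor>Q * b\<rfloor> - int N}"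
    hence lower: "Q * a < i" by (simp add: floor_less_iff flip: zless_iff_Suc_zadd) linarith
    have "i + int N \<le> \<lfloor>Q * b\<rfloor>" using i by simp
    hence "real_of_int (i + int N) \<le> Q * b" by (simp only: le_floor_iff)
    hence upper: "i + real N \<le> Q * b" by simp
    have "0 \<le> real Q * a" using a0 by simp
    hence "real_of_int i > 0" using lower by linarith
    hence "i \<ge> 0" by simp
    moreover have "Q * b \<le> Q" using b1 Q by (simp add: mult_left_le)
    hence "real_of_int i < real_of_int (int Q)" using upper N by simp
    hence "i < int Q" by (simp only: of_int_less_iff)
    moreover have "x \<in> I" if "i / Q \<le> x" "x < (i + real N) / Q" for x
    proof (rule sup)
      have "real_of_int i \<le> real Q * x" using that(1) Q by (simp add: divide_le_eq mult.commute)
      hence "real Q * a < real Q * x" using lower by linarith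
      thus "a < x" using Q by simp
      have "real Q * x < i + real N" using that(2) Q by (simp add: less_divide_eq mult.commute)
      hence "real Q * x < real Q * b" using upper by linarith
      thus "x < b" using Q by simp
    qed
    ultimately show "i \<in> grid_inside Q N I" by (auto simp: grid_inside_def)
  qed
  hence "card {\<lfloor>Q * a\<rfloor> + 1..\<lfloor>Q * b\<rfloor> - int N} \<le> card (grid_inside Q N I)"
    by (intro card_mono) auto
  hence "\<lfloor>Q * b\<rfloor> - int N - \<lfloor>Q * a\<rfloor> \<le> int (card (grid_inside Q N I))"
    by simp
  hence "real_of_int (\<lfloor>Q * b\<rfloor> - int N - \<lfloor>Q * a\<rfloor>) \<le> real_of_int (int (card (grid_inside Q N I)))"
    by (simp only: of_int_le_iff)
  hence "real Q * b - 1 - N - Q * a \<le> card (grid_inside Q N I)"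
    by simp linarith
  moreover have "real Q * measure lebesgue I \<le> Q * (b - a)"
    using meas by (intro mult_left_mono) auto
  ultimately show ?thesis by (simp add: algebra_simps)
qed

text \<open>Each interval yields a run of consecutive residues, so it loses at most
  \<open>N + 1\<close> grid points and contributes at most two boundary points.\<close>

lemma grid_approximation:
  assumes fin: "finite \<I>" and int: "\<And>I. I \<in> \<I> \<Longrightarrow> is_interval I" and disj: "disjoint \<I>"
    and R: "\<Union>\<I> \<subseteq> {0..<1}" and Q: "Q > 0" and N: "N > 0"
  shows "\<exists>G \<subseteq> {0..<int Q}.
    real Q * measure lebesgue (\<Union>\<I>) - real (card \<I>) * (real N + 1) \<le> real (card G) \<and>
    card {j \<in> {0..<int Q}. (j \<in> G) \<noteq> ((j + 1) mod int Q \<in> G)} \<le> 2 * card \<I> \<and>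
    (\<forall>i\<in>G. {of_int i / real Q..<(of_int i + real N) / real Q} \<subseteq> \<Union>\<I>)"
proof -
  let ?g = "grid_inside Q N"
  define G where "G = (\<Union>I\<in>\<I>. ?g I)"
  have G_sub: "G \<subseteq> {0..<int Q}" by (auto simp: G_def grid_inside_def)
  have cells: "\<forall>i\<in>G. {of_int i / real Q..<(of_int i + real N) / real Q} \<subseteq> \<Union>\<I>"
    by (auto simp: G_def grid_inside_def)
  have left: "of_int i / Q \<in> I" if "i \<in> ?g I" for i I
  proof -
    have "of_int i / Q \<in> {of_int i / real Q..<(of_int i + real N) / real Q}"
      using Q N by (simp add: divide_strict_right_mono)
    thus ?thesis using that unfolding grid_inside_def by blast
  qed
  have "card G = (\<Sum>I\<in>\<I>. card (?g I))"
    unfolding G_def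
  proof (intro card_UN_disjoint fin ballI impI)
    fix I J assume IJ: "I \<in> \<I>" "J \<in> \<I>" "I \<noteq> J"
    hence "I \<inter> J = {}" using disj by (auto simp: disjoint_def)
    thus "?g I \<inter> ?g J = {}" using left by blast
  qed simp
  moreover have "(\<Sum>I\<in>\<I>. real Q * measure lebesgue I - (real N + 1)) \<le> (\<Sum>I\<in>\<I>. real (card (?g I)))"
    using R int Q N by (intro sum_mono card_grid_inside_ge) auto
  moreover have "measure lebesgue (\<Union>\<I>) \<le> (\<Sum>I\<in>\<I>. measure lebesgue I)"
  proof -
    have "convex I \<and> bounded I" if "I \<in> \<I>" for I
      using int[OF that] that R bounded_subset[of "{0..<1::real}" I]
      by (auto simp: is_interval_convex_1)
    hence "I \<in> lmeasurable" if "I \<in> \<I>" for I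
      using that measurable_convex by blast
    thus ?thesis using measure_UNION_le[OF fin, of "\<lambda>I. I" lebesgue] by auto
  qed
  hence "real Q * measure lebesgue (\<Union>\<I>) \<le> real Q * (\<Sum>I\<in>\<I>. measure lebesgue I)"
    by (intro mult_left_mono) auto
  ultimately have card_G: "real Q * measure lebesgue (\<Union>\<I>) - real (card \<I>) * (real N + 1) \<le> real (card G)"
    by (simp add: sum_subtractf sum_distrib_left)
  \<comment> \<open>The two candidates are the last point of the run and the cyclic predecessor of
    its first point. For an empty run the values are arbitrary and only enlarge the cover.\<close>
  define e where "e I = {Max (?g I), (Min (?g I) - 1) mod int Q}" for I
  have "{j \<in> {0..<int Q}. (j \<in> G) \<noteq> ((j + 1) mod int Q \<in> G)} \<subseteq> (\<Union>I\<in>\<I>. e I)"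
  proof
    fix j assume j: "j \<in> {j \<in> {0..<int Q}. (j \<in> G) \<noteq> ((j + 1) mod int Q \<in> G)}"
    hence jQ: "0 \<le> j" "j < int Q" by auto
    have succ: "(j + 1) mod int Q = (if j + 1 = int Q then 0 else j + 1)"
      using jQ by auto
    show "j \<in> (\<Union>I\<in>\<I>. e I)"
    proof (cases "j \<in> G")
      case True
      then obtain I where I: "I \<in> \<I>" "j \<in> ?g I" by (auto simp: G_def)
      have "i \<le> j" if i: "i \<in> ?g I" for i
      proof (rule ccontr)
        assume "\<not> i \<le> j"
        hence "j + 1 \<in> ?g I"
          using grid_inside_convex[OF int[OF I(1)] Q I(2) i, of "j + 1"] N by auto
        moreover from this have "j + 1 < int Q" by (simp add: grid_inside_def)
        ultimately show False using I j True succ by (auto simp: G_def)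
      qed
      hence "Max (?g I) = j" using I by (intro Max_eqI) auto
      thus ?thesis using I by (auto simp: e_def)
    next
      case False
      then obtain I where I: "I \<in> \<I>" "(j + 1) mod int Q \<in> ?g I" using j by (auto simp: G_def)
      have "(j + 1) mod int Q \<le> i" if i: "i \<in> ?g I" for i
      proof (rule ccontr)
        assume less: "\<not> (j + 1) mod int Q \<le> i"
        have "i \<ge> 0" using i by (simp add: grid_inside_def)
        with less have eq: "(j + 1) mod int Q = j + 1" using succ by (auto split: if_splits)
        hence "j \<in> ?g I"
          using grid_inside_convex[OF int[OF I(1)] Q i I(2), of j] N less by auto
        with I False show False by (auto simp: G_def)
      qed
      hence "Min (?g I) = (j + 1) mod int Q" using I by (intro Min_eqI) auto
      hence "(Min (?g I) - 1) mod int Q = j"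
        using jQ by (simp add: mod_diff_left_eq)
      thus ?thesis using I by (auto simp: e_def)
    qed
  qed
  hence "card {j \<in> {0..<int Q}. (j \<in> G) \<noteq> ((j + 1) mod int Q \<in> G)} \<le> card (\<Union>I\<in>\<I>. e I)"
    using fin by (intro card_mono) (auto simp: e_def)
  also have "\<dots> \<le> (\<Sum>I\<in>\<I>. card (e I))" using fin by (rule card_UN_le)
  also have "\<dots> \<le> (\<Sum>I\<in>\<I>. 2)" by (intro sum_mono) (simp add: e_def card_insert_if)
  finally have "card {j \<in> {0..<int Q}. (j \<in> G) \<noteq> ((j + 1) mod int Q \<in> G)} \<le> 2 * card \<I>"
    by simp
  with G_sub card_G cells show ?thesis by blast
qed

text \<open>Write \<open>\<alpha> = (j + \<theta>) / Q\<close>. If \<open>h * j\<close> reduces to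
  some \<open>i\<close> in \<open>G\<close>, then \<open>h * \<alpha>\<close> is congruent modulo 1
  to a point in the window of \<open>i\<close>, hence in \<open>S\<close>. So an
  \<open>\<alpha>\<close> that always misses \<open>S\<close> lies in a cell with bad index
  \<open>j\<close>, and the union of these cells is a measurable cover.\<close>

lemma bad_set_cover:
  assumes Q: "Q > 0" and S: "\<And>i. i \<in> G \<Longrightarrow> {of_int i / real Q..<(of_int i + real N) / real Q} \<subseteq> S"
    and S01: "S \<subseteq> {0..<1}" and H: "\<And>h. h \<in> H \<Longrightarrow> 0 < h \<and> h \<le> N"
  shows "\<exists>U \<in> sets lebesgue. {\<alpha> \<in> {0..<1}. \<forall>h. 0 < h \<and> h \<le> N \<longrightarrow> frac (real h * \<alpha>) \<notin> S} \<subseteq> U \<and>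
    emeasure lebesgue U \<le> ennreal (real (card {j \<in> {0..<int Q}. \<forall>h\<in>H. (int h * j) mod int Q \<notin> G}) / real Q)"
proof -
  define bad where "bad = {j \<in> {0..<int Q}. \<forall>h\<in>H. (int h * j) mod int Q \<notin> G}"
  define J where "J j = {of_int j / real Q..<(of_int j + 1) / real Q}" for j :: int
  have fin: "finite bad" by (rule finite_subset[of _ "{0..<int Q}"]) (auto simp: bad_def)
  show ?thesis unfolding bad_def[symmetric]
  proof (intro bexI[of _ "\<Union>j\<in>bad. J j"] conjI subsetI)
    show "(\<Union>j\<in>bad. J j) \<in> sets lebesgue" using fin by (auto simp: J_def)
    have "emeasure lebesgue (\<Union>j\<in>bad. J j) \<le> (\<Sum>j\<in>bad. emeasure lebesgue (J j))"
      using fin by (intro emeasure_subadditive_finite) (auto simp: J_def)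
    also have "\<dots> = (\<Sum>j\<in>bad. ennreal (1 / real Q))"
      using Q by (intro sum.cong) (auto simp: J_def divide_right_mono simp flip: diff_divide_distrib)
    also have "\<dots> = ennreal (real (card bad) / real Q)"
      by (simp add: ennreal_of_nat_eq_real_of_nat flip: ennreal_mult')
    finally show "emeasure lebesgue (\<Union>j\<in>bad. J j) \<le> ennreal (real (card bad) / real Q)" .
  next
    fix \<alpha> assume "\<alpha> \<in> {\<alpha> \<in> {0..<1}. \<forall>h. 0 < h \<and> h \<le> N \<longrightarrow> frac (real h * \<alpha>) \<notin> S}"
    hence a: "0 \<le> \<alpha>" "\<alpha> < 1" and notin: "\<And>h. 0 < h \<Longrightarrow> h \<le> N \<Longrightarrow> frac (real h * \<alpha>) \<notin> S" by auto
    define j where "j = \<lfloor>real Q * \<alpha>\<rfloor>"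
    define \<theta> where "\<theta> = frac (real Q * \<alpha>)"
    have \<theta>: "0 \<le> \<theta>" "\<theta> < 1" by (simp_all add: \<theta>_def frac_lt_1)
    have "real Q * \<alpha> = j + \<theta>" by (simp add: j_def \<theta>_def frac_def)
    hence \<alpha>: "\<alpha> = (j + \<theta>) / Q" using Q by (simp add: field_simps)
    have "j \<ge> 0" using a by (simp add: j_def)
    moreover have "real Q * \<alpha> < real Q" using a Q by simp
    hence "j < int Q" by (simp add: j_def floor_less_iff)
    moreover have "(int h * j) mod int Q \<notin> G" if h: "h \<in> H" for h
    proof
      define i where "i = (int h * j) mod int Q"
      assume "(int h * j) mod int Q \<in> G"
      hence "{of_int i / real Q..<(of_int i + real N) / real Q} \<subseteq> S" using S by (simp add: i_def)
      moreover have hN: "0 < h" "h \<le> N" using H[OF h] by auto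
      have "real h * \<theta> < real N"
        using hN \<theta> mult_strict_left_mono[of \<theta> 1 "real h"] by linarith
      hence "(i + real h * \<theta>) / Q \<in> {of_int i / real Q..<(of_int i + real N) / real Q}"
        using Q \<theta> by (auto simp: divide_right_mono divide_strict_right_mono)
      ultimately have mem: "(i + real h * \<theta>) / Q \<in> S" by blast
      have "real_of_int (int h * j) = of_int ((int h * j) div int Q * int Q + i)"
        unfolding i_def by simp
      hence "real h * \<alpha> = (i + real h * \<theta>) / Q + of_int ((int h * j) div int Q)"
        using Q unfolding \<alpha> by (simp add: field_simps)
      \<comment> \<open>Since \<open>S\<close> lies in the unit interval, this point is its own
        fractional part.\<close>
      moreover have "0 \<le> (i + real h * \<theta>) / Q" "(i + real h * \<theta>) / Q < 1" using mem S01 by auto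
      ultimately have "frac (real h * \<alpha>) = (i + real h * \<theta>) / Q"
        by (auto simp: frac_unique_iff)
      with mem notin[OF hN] show False by simp
    qed
    ultimately have "j \<in> bad" by (simp add: bad_def)
    moreover have "\<alpha> \<in> J j" using \<theta> Q by (auto simp: \<alpha> J_def divide_right_mono divide_strict_right_mono)
    ultimately show "\<alpha> \<in> (\<Union>j\<in>bad. J j)" by blast
  qed
qed

subsection \<open>Measure of the exceptional sets\<close>

text \<open>Chebyshev's bound at \<open>N div 2\<close>. Dropping the prime 2 raises the additive
  constant from 1 to 2, and rounding to an even number costs at most 1 on the left.\<close>

lemma odd_prime_count_lower:
  fixes N t :: nat
  assumes "N \<ge> 2" "N \<le> 2 ^ t"
  shows "real N - 1 \<le> (real (card {q. prime q \<and> q \<le> N \<and> q \<noteq> 2}) + 2) * real t"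
proof -
  define n where "n = N div 2"
  have n: "n > 0" "2 * n \<le> N" "N - 1 \<le> 2 * n" using assms(1) by (auto simp: n_def)
  have "card {p. prime p \<and> p \<le> 2 * n} \<le> card (insert 2 {q. prime q \<and> q \<le> N \<and> q \<noteq> 2})"
    using n by (intro card_mono) auto
  also have "\<dots> \<le> card {q. prime q \<and> q \<le> N \<and> q \<noteq> 2} + 1"
    by (simp add: card_insert_if)
  finally have card: "real (card {p. prime p \<and> p \<le> 2 * n}) + 1
      \<le> real (card {q. prime q \<and> q \<le> N \<and> q \<noteq> 2}) + 2"
    by linarith
  have "2 * n \<le> 2 ^ t" using n assms by linarith
  hence "real (2 * n) \<le> real (2 ^ t)" by (simp only: of_nat_le_iff)
  hence "log 2 (real (2 * n)) \<le> log 2 (2 ^ t)"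
    using n by (subst log_le_cancel_iff) auto
  hence log_le: "log 2 (real (2 * n)) \<le> real t" by (simp add: log_nat_power)
  have "log 2 (real (2 * n)) \<ge> 0" using n by (intro zero_le_log_cancel_iff[THEN iffD2]) auto
  with card log_le have "2 * real n \<le> (real (card {q. prime q \<and> q \<le> N \<and> q \<noteq> 2}) + 2) * real t"
    by (intro order_trans[OF chebyshev_prime_count_lower[OF n(1)]] mult_mono) auto
  thus ?thesis using n by linarith
qed

text \<open>The previous bounds with all scales expressed through \<open>E = 2 ^ t\<close>. The
  first error term comes from low frequencies, with \<open>8 * t\<close> bounding the number of
  representations, and the second from high ones.\<close>

lemma bad_set_small:
  fixes \<I> :: "real set set" and N t :: nat
  defines "S \<equiv> \<Union>\<I>"
  defines "h \<equiv> card {q::nat. prime q \<and> q \<le> N \<and> q \<noteq> 2}"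
  assumes fin: "finite \<I>" and int: "\<And>I. I \<in> \<I> \<Longrightarrow> is_interval I" and disj: "disjoint \<I>"
    and S01: "S \<subseteq> {0..<1}" and t: "t \<ge> 2" and card: "card \<I> \<le> 2 ^ t"
    and S_large: "1 \<le> measure lebesgue S * 2 ^ t" and N: "N \<le> 2 ^ t" and h: "h > 0"
  shows "\<exists>U\<in>sets lebesgue. {\<alpha> \<in> {0..<1}. \<forall>h. 0 < h \<and> h \<le> N \<longrightarrow> frac (real h * \<alpha>) \<notin> S} \<subseteq> U \<and>
    emeasure lebesgue U \<le> ennreal (32 * real t / (real h * measure lebesgue S) + 4 / 2 ^ t)"
proof -
  define E :: nat where "E = 2 ^ t"
  define p where "p = measure lebesgue S"
  \<comment> \<open>The modulus is a power of 2, so every odd prime is coprime to it. The exponents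
    give \<open>Q = E ^ 8\<close> and \<open>N * K \<le> E ^ 7 < M\<close>, so low-frequency
    products do not wrap around.\<close>
  define M :: nat where "M = 2 ^ (8 * t - 1)"
  define Q where "Q = 2 * M"
  define K where "K = E ^ 6"
  define H where "H = {q::nat. prime q \<and> q \<le> N \<and> q \<noteq> 2}"
  have Q_eq: "Q = E ^ 8"
    using t by (simp add: Q_def M_def E_def mult.commute flip: power_Suc power_mult)
  have E4: "E \<ge> 4" using power_increasing[OF t, of "2::nat"] by (simp add: E_def)
  have M: "M > 0" and Q: "Q > 0" and K: "K > 0" using E4 by (auto simp: M_def Q_def K_def)
  have finH: "finite H" by (simp add: H_def)
  have cardH: "card H = h" by (simp add: H_def h_def)
  have N0: "N > 0"
  proof (rule ccontr)
    assume "\<not> N > 0"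
    hence "H = {}" by (auto simp: H_def prime_gt_0_nat)
    thus False using h cardH by simp
  qed
  have pE: "1 \<le> p * E" using S_large by (simp add: p_def E_def)
  have p0: "p > 0" using pE E4 by (smt (verit) mult_nonpos_nonneg of_nat_0_le_iff)
  obtain G where G: "G \<subseteq> {0..<int Q}"
    "real (card G) \<ge> real Q * p - real (card \<I>) * (real N + 1)"
    "card {j \<in> {0..<int Q}. (j \<in> G) \<noteq> ((j + 1) mod int Q \<in> G)} \<le> 2 * card \<I>"
    "\<And>i. i \<in> G \<Longrightarrow> {of_int i / real Q..<(of_int i + real N) / real Q} \<subseteq> S"
    using grid_approximation[OF fin int disj S01[unfolded S_def] Q N0] unfolding S_def p_def by blast
  define \<rho> where "\<rho> = real (card G) / real Q"
  define bad where "bad = {j \<in> {0..<int Q}. \<forall>q\<in>H. (int q * j) mod int Q \<notin> G}"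
  \<comment> \<open>Discretisation loses at most \<open>2 * E ^ 2\<close> residues, and
    \<open>p * E \<ge> 1\<close> makes this at most half of \<open>Q * p\<close>.\<close>
  have \<rho>: "\<rho> \<ge> p / 2"
  proof -
    have "real (card \<I>) * (real N + 1) \<le> real E * (real E + real E)"
      using card N E4 by (intro mult_mono) (auto simp: E_def simp flip: of_nat_power intro!: add_mono)
    also have "\<dots> = real E ^ 2 * 2" by (simp add: power2_eq_square)
    also have "\<dots> \<le> real E ^ 2 * (real E ^ 5 / 2)"
      using E4 power_mono[of 4 "real E" 5] by (intro mult_left_mono) auto
    also have "\<dots> = real E ^ 7 * 1 / 2" by (simp add: eval_nat_numeral)
    also have "\<dots> \<le> real E ^ 7 * (p * real E) / 2"
      using pE by (intro divide_right_mono mult_left_mono) auto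
    also have "\<dots> = real Q * p / 2" by (simp add: Q_eq eval_nat_numeral)
    finally have "real (card G) \<ge> real Q * p / 2" using G(2) by linarith
    thus ?thesis using Q by (simp add: \<rho>_def field_simps)
  qed
  have \<rho>0: "\<rho> > 0" using \<rho> p0 by linarith
  have NK_le: "N * K \<le> 2 ^ (7 * t)"
  proof -
    have "N * K \<le> E * E ^ 6" unfolding K_def using N by (intro mult_right_mono) (auto simp: E_def)
    also have "\<dots> = E ^ 7" by (simp add: eval_nat_numeral)
    also have "\<dots> = 2 ^ (7 * t)" by (simp add: E_def mult.commute flip: power_mult)
    finally show ?thesis .
  qed
  have "(2::nat) ^ (7 * t) < M" unfolding M_def using t by (intro power_strict_increasing) auto
  with NK_le have NK: "N * K < M" "N * K < 2 ^ (8 * t)"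
    using t power_strict_increasing[of "7 * t" "8 * t" "2::nat"] by linarith+
  have "real (card bad) * (real h * \<rho>)\<^sup>2
      \<le> 2 * real (8 * t) * real h * real Q * \<rho> + (real h * real Q)\<^sup>2 * real (2 * card \<I>) / (2 * real K ^ 2)"
    unfolding bad_def Q_def \<rho>_def cardH[symmetric]
  proof (rule bad_residues_bound[OF M K _ finH _ NK])
    show "G \<subseteq> {0..<int (2 * M)}" using G(1) by (simp add: Q_def)
    show "card {j \<in> {0..<int (2 * M)}. (j \<in> G) \<noteq> ((j + 1) mod int (2 * M) \<in> G)} \<le> 2 * card \<I>"
      using G(3) by (simp add: Q_def)
    fix q assume q: "q \<in> H"
    hence "odd q" using primes_dvd_imp_eq[of 2 q] by (auto simp: H_def)
    thus "prime q \<and> q \<le> N \<and> coprime q (2 * M)"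
      using q by (auto simp: H_def M_def)
  qed
  also have "\<dots> = real Q * (real h * \<rho>)\<^sup>2 *
      (16 * real t / (real h * \<rho>) + real Q * real (card \<I>) / (real K ^ 2 * \<rho>\<^sup>2))"
    using h \<rho>0 K by (simp add: field_simps power2_eq_square)
  finally have "real (card bad) \<le> real Q *
      (16 * real t / (real h * \<rho>) + real Q * real (card \<I>) / (real K ^ 2 * \<rho>\<^sup>2))"
    using h \<rho>0 by (simp add: mult.commute mult.left_commute)
  hence "real (card bad) / real Q
      \<le> 16 * real t / (real h * \<rho>) + real Q * real (card \<I>) / (real K ^ 2 * \<rho>\<^sup>2)"
    using Q by (simp add: divide_le_eq mult.commute)
  also have "16 * real t / (real h * \<rho>) \<le> 16 * real t / (real h * (p / 2))"
    using \<rho> p0 h by (intro divide_left_mono mult_left_mono mult_pos_pos) auto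
  also have "real Q * real (card \<I>) / (real K ^ 2 * \<rho>\<^sup>2) \<le> real E ^ 8 * real E / (real E ^ 12 * (p / 2)\<^sup>2)"
  proof (intro frac_le mult_mono)
    show "real (card \<I>) \<le> real E" using card by (simp add: E_def flip: of_nat_power)
    show "(p / 2)\<^sup>2 \<le> \<rho>\<^sup>2" using \<rho> p0 by (intro power_mono) auto
  qed (use E4 p0 in \<open>auto simp: Q_eq K_def simp flip: power_mult\<close>)
  \<comment> \<open>The choice \<open>K = E ^ 6\<close> leaves three spare powers of
    \<open>E\<close>: two are absorbed by \<open>p * E \<ge> 1\<close> and one gives the
    decay.\<close>
  also have "\<dots> = 4 / (real E * (p * real E)\<^sup>2)"
    using E4 p0 by (simp add: field_simps eval_nat_numeral)
  also have "\<dots> \<le> 4 / (real E * 1)"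
    using E4 pE p0 by (intro divide_left_mono mult_left_mono) (auto simp: one_le_power)
  also have "16 * real t / (real h * (p / 2)) = 32 * real t / (real h * p)"
    by simp
  finally have "real (card bad) / real Q \<le> 32 * real t / (real h * p) + 4 / 2 ^ t"
    by (simp add: E_def)
  hence "ennreal (real (card bad) / real Q) \<le> ennreal (32 * real t / (real h * p) + 4 / 2 ^ t)"
    by (rule ennreal_leI)
  moreover have "\<exists>U\<in>sets lebesgue. {\<alpha> \<in> {0..<1}. \<forall>h. 0 < h \<and> h \<le> N \<longrightarrow> frac (real h * \<alpha>) \<notin> S} \<subseteq> U \<and>
      emeasure lebesgue U \<le> ennreal (real (card bad) / real Q)"
    unfolding bad_def using G(4) S01
    by (intro bad_set_cover[OF Q]) (auto simp: H_def prime_gt_0_nat)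
  ultimately show ?thesis unfolding p_def by (meson order_trans)
qed

section \<open>From vanishing measure bounds to almost every point\<close>

text \<open>A point that is eventually in every \<open>F L\<close> lies in some tail intersection
  \<open>V k\<close>. That set is contained in covers of arbitrarily small measure, hence null, and
  there are countably many \<open>k\<close>.\<close>

lemma AE_frequently_notin:
  fixes F :: "nat \<Rightarrow> 'a set"
  assumes cover: "\<forall>\<^sub>F L in sequentially. \<exists>U\<in>sets M. F L \<subseteq> U \<and> emeasure M U \<le> ennreal (\<epsilon> L)"
    and lim: "\<epsilon> \<longlonglongrightarrow> 0"
  shows "AE x in M. \<exists>\<^sub>\<infinity>L. x \<notin> F L"
proof -
  from cover obtain L0 where "\<forall>L\<ge>L0. \<exists>U\<in>sets M. F L \<subseteq> U \<and> emeasure M U \<le> ennreal (\<epsilon> L)"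
    unfolding eventually_sequentially by blast
  then obtain U where U: "\<And>L. L \<ge> L0 \<Longrightarrow> U L \<in> sets M" "\<And>L. L \<ge> L0 \<Longrightarrow> F L \<subseteq> U L"
    "\<And>L. L \<ge> L0 \<Longrightarrow> emeasure M (U L) \<le> ennreal (\<epsilon> L)"
    by metis
  define V where "V k = (\<Inter>L\<in>{L0 + k..}. U L)" for k
  have "V k \<in> null_sets M" for k
  proof
    show sets: "V k \<in> sets M" unfolding V_def using U(1) by (intro sets.countable_INT') auto
    have "(\<lambda>L. ennreal (\<epsilon> L)) \<longlonglongrightarrow> ennreal 0" using lim by (intro tendsto_ennrealI)
    moreover have "\<forall>\<^sub>F L in sequentially. emeasure M (V k) \<le> ennreal (\<epsilon> L)"
      unfolding eventually_sequentially
    proof (intro exI[of _ "L0 + k"] allI impI)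
      fix L assume L: "L0 + k \<le> L"
      have "emeasure M (V k) \<le> emeasure M (U L)"
        using L U(1) by (intro emeasure_mono) (auto simp: V_def)
      also have "\<dots> \<le> ennreal (\<epsilon> L)" using L U(3) by simp
      finally show "emeasure M (V k) \<le> ennreal (\<epsilon> L)" .
    qed
    ultimately have "emeasure M (V k) \<le> ennreal 0"
      by (rule tendsto_lowerbound) simp
    thus "emeasure M (V k) = 0" by simp
  qed
  hence "AE x in M. \<forall>k. x \<notin> V k"
    by (subst AE_all_countable) (auto intro: AE_not_in)
  thus ?thesis
  proof eventually_elim
    case (elim x)
    show ?case unfolding INFM_nat_le
    proof
      fix k
      have "x \<notin> V k" using elim by blast
      then obtain L where "L \<ge> L0 + k" "x \<notin> U L" by (auto simp: V_def)
      thus "\<exists>L\<ge>k. x \<notin> F L" using U(2)[of L] by (intro exI[of _ L]) auto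
    qed
  qed
qed

text \<open>The theorem for one fixed \<open>\<eta>\<close>. The bound \<open>\<eta> \<le> 1\<close>
  keeps \<open>N L\<close> below \<open>(2 * B) ^ L\<close>, so a scale exponent linear in
  \<open>L\<close> suffices.\<close>

lemma AE_frequently_hit:
  fixes A B \<eta> :: real and R :: "nat \<Rightarrow> real set"
  assumes A: "A > 0" and B: "B > 0" and R_sets: "\<And>L. R L \<in> sets lebesgue"
    and R01: "\<And>L. R L \<subseteq> {0..<1}"
    and R_ge: "\<And>L. measure lebesgue (R L) \<ge> B powr (- real L)"
    and R_int: "\<And>L. disjoint_union_of_at_most_intervals (A ^ L) (R L)"
    and \<eta>: "0 < \<eta>" "\<eta> \<le> 1"
  shows "AE \<alpha> in lebesgue. \<alpha> \<in> {0..<1} \<longrightarrow>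
     (\<exists>\<^sub>\<infinity>L. \<exists>h::nat. h > 0 \<and> real h \<le> (1 + \<eta>) ^ L * (1 / measure lebesgue (R L)) \<and>
        frac (real h * \<alpha>) \<in> R L)"
proof -
  define p where "p L = measure lebesgue (R L)" for L
  define N where "N L = nat \<lfloor>(1 + \<eta>) ^ L * (1 / p L)\<rfloor>" for L
  define F where "F L = {\<alpha> \<in> {0..<1}. \<forall>h. 0 < h \<and> h \<le> N L \<longrightarrow> frac (real h * \<alpha>) \<notin> R L}" for L
  obtain d where "max A (2 * B) < 2 ^ d"
    using real_arch_pow[of 2 "max A (2 * B)"] by auto
  moreover have "(2::real) ^ d \<le> 2 ^ Suc d" by simp
  ultimately have d: "A \<le> 2 ^ Suc d" "2 * B \<le> 2 ^ Suc d" by linarith+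
  \<comment> \<open>The exponent makes \<open>2 ^ t L\<close> dominate both \<open>A ^ L\<close> and
    \<open>(2 * B) ^ L\<close>. Using \<open>Suc d\<close> keeps \<open>t L\<close> growing even
    when \<open>d = 0\<close>.\<close>
  define t where "t L = Suc d * L" for L
  have two_t: "2 ^ t L = (2 ^ Suc d :: 'a :: comm_semiring_1) ^ L" for L
    unfolding t_def by (rule power_mult)
  \<comment> \<open>This will be a lower bound for \<open>h * p L\<close>, where \<open>h\<close>
    counts the odd primes up to \<open>N L\<close>. It grows exponentially up to a factor of order
    \<open>1 / L\<close>, so it beats \<open>t L\<close>.\<close>
  define x where "x L = ((1 + \<eta>) ^ L - 2) / real (t L) - 2" for L
  define \<epsilon> where "\<epsilon> L = 32 * real (t L) / x L + 4 / 2 ^ t L" for L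
  have lim: "\<epsilon> \<longlonglongrightarrow> 0"
  proof -
    have "(\<lambda>L. 32 * (c * real L) / (((1 + \<eta>) ^ L - 2) / (c * real L) - 2)) \<longlonglongrightarrow> 0"
      if "c > 0" for c :: real
      using that \<eta>(1) by real_asymp
    from this[of "real (Suc d)"] have "(\<lambda>L. 32 * real (t L) / x L) \<longlonglongrightarrow> 0"
      unfolding x_def t_def of_nat_mult by simp
    moreover have "(\<lambda>L. 4 / r ^ L) \<longlonglongrightarrow> 0" if "r > 1" for r :: real
      using that by real_asymp
    from this[of "2 ^ Suc d"] have "(\<lambda>L. 4 / 2 ^ t L :: real) \<longlonglongrightarrow> 0"
      unfolding two_t using one_less_power[of "2::real" "Suc d"] by simp
    ultimately show ?thesis
      unfolding \<epsilon>_def by (rule tendsto_add_zero)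
  qed
  have p_le: "p L \<le> 1" for L
  proof -
    have "R L \<subseteq> {0..1}" using R01[of L] by auto
    hence "p L \<le> measure lebesgue {0..1::real}"
      unfolding p_def using R_sets by (intro measure_mono_fmeasurable) auto
    thus ?thesis by simp
  qed
  have p_pos: "p L > 0" for L
    using R_ge[of L] B by (smt (verit) p_def powr_gt_zero)
  have p_inv: "1 / p L \<le> B ^ L" for L
  proof -
    have "1 / p L \<le> 1 / (B powr (- real L))"
      using R_ge[of L] B by (intro divide_left_mono) (auto simp: p_def p_pos[unfolded p_def])
    thus ?thesis using B by (simp add: powr_minus powr_realpow field_simps)
  qed
  have "\<forall>\<^sub>F L in sequentially. 3 \<le> (1 + \<eta>) ^ L"
    using \<eta>(1) by real_asymp
  moreover have "\<forall>\<^sub>F L in sequentially. 0 < x L"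
    unfolding x_def t_def of_nat_mult using \<eta>(1) by real_asymp
  moreover have "\<forall>\<^sub>F L in sequentially. L \<ge> 2"
    by (rule eventually_ge_at_top)
  ultimately have "\<forall>\<^sub>F L in sequentially. \<exists>U\<in>sets lebesgue. F L \<subseteq> U \<and> emeasure lebesgue U \<le> ennreal (\<epsilon> L)"
  proof eventually_elim
    case (elim L)
    define h where "h = card {q. prime q \<and> q \<le> N L \<and> q \<noteq> 2}"
    have pow3: "3 \<le> (1 + \<eta>) ^ L" and xpos: "0 < x L" and L: "L \<ge> 2" using elim by auto
    have t2: "t L \<ge> 2" using L by (simp add: t_def)
    have y: "(1 + \<eta>) ^ L * (1 / p L) \<ge> 3"
      using mult_mono[of 3 "(1 + \<eta>) ^ L" 1 "1 / p L"] pow3 p_pos[of L] p_le[of L] by (simp add: field_simps)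
    have N_le: "real (N L) \<le> (1 + \<eta>) ^ L * (1 / p L)"
      and N_ge: "(1 + \<eta>) ^ L * (1 / p L) - 1 \<le> real (N L)"
      using y unfolding N_def by linarith+
    have "(1 + \<eta>) ^ L * (1 / p L) \<le> 2 ^ L * B ^ L"
      using \<eta> p_inv[of L] p_pos[of L] by (intro mult_mono power_mono) auto
    also have "\<dots> = (2 * B) ^ L" by (simp add: power_mult_distrib)
    also have "\<dots> \<le> 2 ^ t L" unfolding two_t using d(2) B by (intro power_mono) auto
    finally have upper: "(1 + \<eta>) ^ L * (1 / p L) \<le> 2 ^ t L" .
    hence "real (N L) \<le> real (2 ^ t L)" using N_le unfolding of_nat_power of_nat_numeral by linarith
    hence N_le': "N L \<le> 2 ^ t L" by (simp only: of_nat_le_iff)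
    have N2: "N L \<ge> 2" using N_ge y by linarith
    have "1 * (1 / p L) \<le> (1 + \<eta>) ^ L * (1 / p L)"
      using pow3 p_pos[of L] by (intro mult_right_mono) auto
    hence pE: "1 \<le> p L * 2 ^ t L"
      using upper p_pos[of L] by (simp add: field_simps)
    \<comment> \<open>One unit is lost to the floor in \<open>N L\<close> and one to the prime
      count. Multiplying by \<open>p L \<le> 1\<close> then removes the dependence on the measure
      and produces \<open>x L\<close>.\<close>
    have "(1 + \<eta>) ^ L * (1 / p L) - 2 \<le> (real h + 2) * real (t L)"
      using odd_prime_count_lower[OF N2 N_le'] N_ge unfolding h_def by linarith
    hence "((1 + \<eta>) ^ L * (1 / p L) - 2) * p L \<le> ((real h + 2) * real (t L)) * p L"
      using p_pos[of L] by (intro mult_right_mono) auto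
    hence "(1 + \<eta>) ^ L - 2 * p L \<le> (real h * p L + 2 * p L) * real (t L)"
      using p_pos[of L] by (simp add: algebra_simps)
    also have "\<dots> \<le> (real h * p L + 2) * real (t L)"
      using p_le[of L] by (intro mult_right_mono) auto
    finally have "(1 + \<eta>) ^ L - 2 \<le> (real h * p L + 2) * real (t L)"
      using p_le[of L] by linarith
    hence hp: "x L \<le> real h * p L"
      using t2 unfolding x_def by (simp add: field_simps)
    hence "h > 0" using xpos by (cases h) auto
    from R_int[of L] obtain \<I> where \<I>: "finite \<I>" "real (card \<I>) \<le> A ^ L"
      "\<And>I. I \<in> \<I> \<Longrightarrow> is_interval I" "disjoint \<I>" "\<Union>\<I> = R L"
      unfolding disjoint_union_of_at_most_intervals_def by auto
    have "A ^ L \<le> 2 ^ t L" unfolding two_t using d(1) A by (intro power_mono) auto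
    hence "real (card \<I>) \<le> real (2 ^ t L)"
      using \<I>(2) unfolding of_nat_power of_nat_numeral by linarith
    hence card: "card \<I> \<le> 2 ^ t L" by (simp only: of_nat_le_iff)
    have "\<exists>U\<in>sets lebesgue. F L \<subseteq> U \<and>
        emeasure lebesgue U \<le> ennreal (32 * real (t L) / (real h * p L) + 4 / 2 ^ t L)"
      using bad_set_small[OF \<I>(1,3,4) _ t2 card _ N_le'] \<open>h > 0\<close> R01[of L] pE
      unfolding \<I>(5) F_def h_def p_def by blast
    moreover have "32 * real (t L) / (real h * p L) \<le> 32 * real (t L) / x L"
      using hp xpos by (intro divide_left_mono) (auto intro!: mult_pos_pos)
    hence "ennreal (32 * real (t L) / (real h * p L) + 4 / 2 ^ t L) \<le> ennreal (\<epsilon> L)"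
      unfolding \<epsilon>_def by (intro ennreal_leI) simp
    ultimately show ?case by (meson order_trans)
  qed
  from AE_frequently_notin[OF this lim] show ?thesis
  proof eventually_elim
    case (elim \<alpha>)
    show ?case
    proof
      assume \<alpha>: "\<alpha> \<in> {0..<1}"
      show "\<exists>\<^sub>\<infinity>L. \<exists>h::nat. h > 0 \<and> real h \<le> (1 + \<eta>) ^ L * (1 / measure lebesgue (R L)) \<and>
          frac (real h * \<alpha>) \<in> R L"
        using elim
      proof (rule INFM_mono)
        fix L assume "\<alpha> \<notin> F L"
        then obtain h where h: "0 < h" "h \<le> N L" "frac (real h * \<alpha>) \<in> R L"
          using \<alpha> by (auto simp: F_def)
        have "real (N L) \<le> (1 + \<eta>) ^ L * (1 / p L)"
          using \<eta> p_pos[of L] unfolding N_def by simp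
        thus "\<exists>h>0. real h \<le> (1 + \<eta>) ^ L * (1 / measure lebesgue (R L)) \<and> frac (real h * \<alpha>) \<in> R L"
          using h by (intro exI[of _ h]) (auto simp: p_def)
      qed
    qed
  qed
qed

theorem theorem4:
  fixes A B :: real and R :: "nat \<Rightarrow> real set"
  assumes "A > 0" and "B > 0"
    and "\<And>L. R L \<in> sets lebesgue"
    and "\<And>L. R L \<subseteq> {0..<1}"
    and "\<And>L. measure lebesgue (R L) \<ge> B powr (- real L)"
    and "\<And>L. disjoint_union_of_at_most_intervals (A ^ L) (R L)"
  shows "AE \<alpha> in lebesgue. \<alpha> \<in> {0..<1} \<longrightarrow>
           (\<forall>\<eta>>0. \<exists>\<^sub>\<infinity>L. \<exists>h::nat. h > 0 \<and>
               real h \<le> (1 + \<eta>) ^ L * (1 / measure lebesgue (R L)) \<and>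
               frac (real h * \<alpha>) \<in> R L)"
proof -
  \<comment> \<open>The bound on \<open>h\<close> increases with \<open>\<eta>\<close>, so the
    countably many values \<open>1 / Suc m\<close>, all at most 1, suffice and their null sets can
    be united.\<close>
  have "AE \<alpha> in lebesgue. \<forall>m::nat. \<alpha> \<in> {0..<1} \<longrightarrow>
     (\<exists>\<^sub>\<infinity>L. \<exists>h::nat. h > 0 \<and>
        real h \<le> (1 + 1 / real (Suc m)) ^ L * (1 / measure lebesgue (R L)) \<and>
        frac (real h * \<alpha>) \<in> R L)"
    by (subst AE_all_countable) (intro allI AE_frequently_hit[OF assms], auto)
  thus ?thesis
  proof eventually_elim
    case (elim \<alpha>)
    show ?case
    proof (intro impI allI)
      fix \<eta> :: real assume \<alpha>: "\<alpha> \<in> {0..<1}" and \<eta>: "\<eta> > 0"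
      obtain m where m: "inverse (real (Suc m)) < \<eta>"
        using reals_Archimedean[OF \<eta>] by blast
      from elim \<alpha> have "\<exists>\<^sub>\<infinity>L. \<exists>h::nat. h > 0 \<and>
          real h \<le> (1 + 1 / real (Suc m)) ^ L * (1 / measure lebesgue (R L)) \<and>
          frac (real h * \<alpha>) \<in> R L"
        by blast
      thus "\<exists>\<^sub>\<infinity>L. \<exists>h::nat. h > 0 \<and> real h \<le> (1 + \<eta>) ^ L * (1 / measure lebesgue (R L)) \<and>
          frac (real h * \<alpha>) \<in> R L"
      proof (rule INFM_mono)
        fix L
        have "(1 + 1 / real (Suc m)) ^ L * (1 / measure lebesgue (R L))
            \<le> (1 + \<eta>) ^ L * (1 / measure lebesgue (R L))"
          using m by (intro mult_right_mono power_mono) (auto simp: inverse_eq_divide)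
        moreover assume "\<exists>h::nat. h > 0 \<and>
          real h \<le> (1 + 1 / real (Suc m)) ^ L * (1 / measure lebesgue (R L)) \<and>
          frac (real h * \<alpha>) \<in> R L"
        ultimately show "\<exists>h::nat. h > 0 \<and> real h \<le> (1 + \<eta>) ^ L * (1 / measure lebesgue (R L)) \<and>
          frac (real h * \<alpha>) \<in> R L"
          by (meson order_trans)
      qed
    qed
  qed
qed

end
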